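(* Let $p$ be a prime number and let $n$ be a positive integer. Let $X=\mathbb{Z}/(p^n)\times\mathbb{Z}/(p)\times\mathbb{Z}/(p^n)$ and let $\pi\colon \mathbb{Z}/(p^n)\to\mathbb{Z}/(p)$ be the canonical homomorphism. For $(a,b,c)\in X$, let $\sigma_{(a,b,c)}\colon X\to X$ be the (bijective) map defined by $$\sigma_{(a,b,c)}(x,y,z)=\bigl(x-c,\; y+\pi(a-x),\; z-\delta_{a,x-c}\,\delta_{b,\,y+\pi(a-x)}\bigr)$$ for all $(x,y,z)\in X$. Let $r\colon X^2\to X^2$ be the map defined by $$r((a,b,c),(x,y,z))=\bigl(\sigma_{(a,b,c)}(x,y,z),\ \sigma^{-1}_{\sigma_{(a,b,c)}(x,y,z)}(a,b,c)\bigr)$$ for all $(a,b,c),(x,y,z)\in X$. Then $(X,r)$ is a simple solution of the YBE.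
   Context: A solution of the YBE means an involutive, non-degenerate, set-theoretic solution of the Yang--Baxter equation: a pair $(X,r)$ where $X$ is a non-empty set and $r\colon X\times X\to X\times X$ is a map, written $r(x,y)=(\sigma_x(y),\gamma_y(x))$, such that $r^2=\mathrm{id}$, all maps $\sigma_x,\gamma_y\colon X\to X$ are bijective, and $r_{12}r_{23}r_{12}=r_{23}r_{12}r_{23}$ on $X^3$, where $r_{12}=r\times \mathrm{id}_X$ and $r_{23}=\mathrm{id}_X\times r$. A homomorphism of solutions $f\colon (X,r)\to (Y,s)$, with $r(x,y)=(\sigma_x(y),\gamma_y(x))$ and $s(t,z)=(\sigma'_t(z),\gamma'_z(t))$, is a map $f\colon X\to Y$ such that $f(\sigma_x(y))=\sigma'_{f(x)}(f(y))$ and $f(\gamma_y(x))=\gamma'_{f(y)}(f(x))$ for all $x,y\in X$. An epimorphism is a surjective homomorphism; an isomorphism is a bijective homomorphism. A solution $(X,r)$ of the YBE is simple if $|X|>1$ and for every epimorphism of solutions $f\colon (X,r)\to (Y,s)$ either $f$ is an isomorphism or $|Y|=1$. $\delta_{u,v}$ is the Kronecker delta ($1$ if $u=v$, $0$ otherwise), with the product of deltas above regarded as an element of $\mathbb{Z}/(p^n)$. *)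

theory Defs
  imports "HOL-Number_Theory.Residues"
begin

text \<open>A map \<open>r\<close> on pairs is written \<open>r (x, y) = (\<sigma>\<^sub>x y, \<gamma>\<^sub>y x)\<close>. All structures live on an
  explicit carrier set, and a map is only constrained on its carrier.\<close>

definition lact :: "('a \<times> 'a \<Rightarrow> 'a \<times> 'a) \<Rightarrow> 'a \<Rightarrow> 'a \<Rightarrow> 'a" where
  "lact r x y = fst (r (x, y))"

definition ract :: "('a \<times> 'a \<Rightarrow> 'a \<times> 'a) \<Rightarrow> 'a \<Rightarrow> 'a \<Rightarrow> 'a" where
  "ract r y x = snd (r (x, y))"

definition r12 :: "('a \<times> 'a \<Rightarrow> 'a \<times> 'a) \<Rightarrow> 'a \<times> 'a \<times> 'a \<Rightarrow> 'a \<times> 'a \<times> 'a" where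
  "r12 r = (\<lambda>(x, y, z). (fst (r (x, y)), snd (r (x, y)), z))"

definition r23 :: "('a \<times> 'a \<Rightarrow> 'a \<times> 'a) \<Rightarrow> 'a \<times> 'a \<times> 'a \<Rightarrow> 'a \<times> 'a \<times> 'a" where
  "r23 r = (\<lambda>(x, y, z). (x, r (y, z)))"

definition ybe_solution :: "'a set \<Rightarrow> ('a \<times> 'a \<Rightarrow> 'a \<times> 'a) \<Rightarrow> bool" where
  "ybe_solution X r \<longleftrightarrow>
     X \<noteq> {} \<and>
     r \<in> X \<times> X \<rightarrow> X \<times> X \<and>
     (\<forall>u\<in>X \<times> X. r (r u) = u) \<and>
     (\<forall>x\<in>X. bij_betw (lact r x) X X) \<and>
     (\<forall>y\<in>X. bij_betw (ract r y) X X) \<and>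
     (\<forall>t\<in>X \<times> X \<times> X. r12 r (r23 r (r12 r t)) = r23 r (r12 r (r23 r t)))"

definition ybe_hom ::
  "'a set \<Rightarrow> ('a \<times> 'a \<Rightarrow> 'a \<times> 'a) \<Rightarrow> 'b set \<Rightarrow> ('b \<times> 'b \<Rightarrow> 'b \<times> 'b) \<Rightarrow> ('a \<Rightarrow> 'b) \<Rightarrow> bool" where
  "ybe_hom X r Y s f \<longleftrightarrow>
     f \<in> X \<rightarrow> Y \<and>
     (\<forall>x\<in>X. \<forall>y\<in>X. f (lact r x y) = lact s (f x) (f y) \<and>
                    f (ract r y x) = ract s (f y) (f x))"

definition ybe_epi ::
  "'a set \<Rightarrow> ('a \<times> 'a \<Rightarrow> 'a \<times> 'a) \<Rightarrow> 'b set \<Rightarrow> ('b \<times> 'b \<Rightarrow> 'b \<times> 'b) \<Rightarrow> ('a \<Rightarrow> 'b) \<Rightarrow> bool" where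
  "ybe_epi X r Y s f \<longleftrightarrow> ybe_hom X r Y s f \<and> f ` X = Y"

definition ybe_iso ::
  "'a set \<Rightarrow> ('a \<times> 'a \<Rightarrow> 'a \<times> 'a) \<Rightarrow> 'b set \<Rightarrow> ('b \<times> 'b \<Rightarrow> 'b \<times> 'b) \<Rightarrow> ('a \<Rightarrow> 'b) \<Rightarrow> bool" where
  "ybe_iso X r Y s f \<longleftrightarrow> ybe_hom X r Y s f \<and> bij_betw f X Y"

text \<open>A definition in HOL cannot quantify over types, so the type of the elements of the target
  \<open>Y\<close> is a parameter; a theorem that leaves \<open>'b\<close> as a type variable speaks about targets over
  every type. The condition \<open>|X| > 1\<close> is spelled out by two distinct elements because \<^const>\<open>card\<close>
  is \<open>0\<close> on infinite sets.\<close>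

definition simple_ybe_solution ::
  "'b itself \<Rightarrow> 'a set \<Rightarrow> ('a \<times> 'a \<Rightarrow> 'a \<times> 'a) \<Rightarrow> bool" where
  "simple_ybe_solution _ X r \<longleftrightarrow>
     ybe_solution X r \<and>
     (\<exists>x\<in>X. \<exists>y\<in>X. x \<noteq> y) \<and>
     (\<forall>(Y :: 'b set) s f. ybe_solution Y s \<and> ybe_epi X r Y s f \<longrightarrow>
        ybe_iso X r Y s f \<or> card Y = 1)"

text \<open>\<open>\<int>/(p\<^sup>n)\<close> and \<open>\<int>/(p)\<close> are the rings \<^const>\<open>residue_ring\<close>, whose elements are the least
  nonnegative representatives; on these the canonical map \<open>\<int>/(p\<^sup>n) \<rightarrow> \<int>/(p)\<close> is reduction
  modulo \<open>p\<close>.\<close>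

abbreviation Zpn :: "nat \<Rightarrow> nat \<Rightarrow> int ring" where
  "Zpn p n \<equiv> residue_ring (int (p ^ n))"

abbreviation Zp :: "nat \<Rightarrow> int ring" where
  "Zp p \<equiv> residue_ring (int p)"

definition canonical_proj :: "nat \<Rightarrow> int \<Rightarrow> int" where
  "canonical_proj p x = x mod int p"

definition kronecker :: "int ring \<Rightarrow> int \<Rightarrow> int \<Rightarrow> int" where
  "kronecker R u v = (if u = v then \<one>\<^bsub>R\<^esub> else \<zero>\<^bsub>R\<^esub>)"

definition sol_carrier :: "nat \<Rightarrow> nat \<Rightarrow> (int \<times> int \<times> int) set" where
  "sol_carrier p n = carrier (Zpn p n) \<times> carrier (Zp p) \<times> carrier (Zpn p n)"

definition sol_sigma ::
  "nat \<Rightarrow> nat \<Rightarrow> int \<times> int \<times> int \<Rightarrow> int \<times> int \<times> int \<Rightarrow> int \<times> int \<times> int" where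
  "sol_sigma p n = (\<lambda>(a, b, c) (x, y, z).
     let x' = x \<ominus>\<^bsub>Zpn p n\<^esub> c;
         y' = y \<oplus>\<^bsub>Zp p\<^esub> canonical_proj p (a \<ominus>\<^bsub>Zpn p n\<^esub> x)
     in (x', y', z \<ominus>\<^bsub>Zpn p n\<^esub> (kronecker (Zpn p n) a x' \<otimes>\<^bsub>Zpn p n\<^esub> kronecker (Zpn p n) b y')))"

definition sol_r ::
  "nat \<Rightarrow> nat \<Rightarrow> (int \<times> int \<times> int) \<times> (int \<times> int \<times> int) \<Rightarrow>
     (int \<times> int \<times> int) \<times> (int \<times> int \<times> int)" where
  "sol_r p n = (\<lambda>(u, v).
     (sol_sigma p n u v,
      inv_into (sol_carrier p n) (sol_sigma p n (sol_sigma p n u v)) u))"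

end

theory Submission
  imports Defs
begin

text \<open>Write \<open>u \<cdot> v = \<sigma>\<^sub>u\<^sup>-\<^sup>1(v)\<close>, so that \<open>r (u, u \<cdot> v) = (v, v \<cdot> u)\<close>; the Yang--Baxter equation amounts
  to the cycle set identity \<open>(u \<cdot> v) \<cdot> (u \<cdot> w) = (v \<cdot> u) \<cdot> (v \<cdot> w)\<close>. With the Kronecker deltas read as
  congruences, the operation lifts to integer triples, where the identity holds exactly.

  For simplicity, let \<open>u = (a, b, c)\<close> and \<open>v = (a', b', c')\<close> be distinct with the same image under an
  epimorphism. Then every \<open>w\<close> has the same image as \<open>\<sigma>\<^sub>v (u \<cdot> w)\<close>, which is \<open>w\<close> shifted by
  \<open>(c - c', a' - a, \<plusminus>\<delta>)\<close>. Choosing \<open>w\<close> with vanishing deltas reduces to \<open>c = c'\<close>. A further shift,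
  repeated \<open>p\<close> times if \<open>p\<close> does not divide \<open>a' - a\<close>, identifies \<open>(a, b, q)\<close> with \<open>(a, b, q + 1)\<close>. This
  spreads to all \<open>(a, b)\<close>, and then the shifts it induces identify neighbours in the first and in the
  second coordinate.\<close>

section \<open>Cycle sets and homomorphisms of solutions\<close>

lemma ybe_solution_from_cycle_set:
  assumes "X \<noteq> {}"
    and sig: "\<And>u v. u \<in> X \<Longrightarrow> v \<in> X \<Longrightarrow> \<sigma> u v \<in> X"
    and dot: "\<And>u v. u \<in> X \<Longrightarrow> v \<in> X \<Longrightarrow> d u v \<in> X"
    and sig_dot: "\<And>u v. u \<in> X \<Longrightarrow> v \<in> X \<Longrightarrow> \<sigma> u (d u v) = v"
    and dot_sig: "\<And>u v. u \<in> X \<Longrightarrow> v \<in> X \<Longrightarrow> d u (\<sigma> u v) = v"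
    and cyc: "\<And>u v w. u \<in> X \<Longrightarrow> v \<in> X \<Longrightarrow> w \<in> X \<Longrightarrow> d (d u v) (d u w) = d (d v u) (d v w)"
    and right: "\<And>v. v \<in> X \<Longrightarrow> bij_betw (\<lambda>u. d (\<sigma> u v) u) X X"
    and r: "\<And>u v. u \<in> X \<Longrightarrow> v \<in> X \<Longrightarrow> r (u, v) = (\<sigma> u v, d (\<sigma> u v) u)"
  shows "ybe_solution X r"
proof -
  have r_dot: "r (u, d u v) = (v, d v u)" if "u \<in> X" "v \<in> X" for u v
    using that by (simp add: r dot sig_dot)
  have left: "bij_betw (lact r u) X X" if "u \<in> X" for u
    by (rule bij_betw_byWitness[where f' = "d u"])
      (use that in \<open>auto simp: lact_def r dot_sig sig_dot sig dot\<close>)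
  have right': "bij_betw (ract r v) X X" if "v \<in> X" for v
    using right[OF that] by (rule bij_betw_cong[THEN iffD1, rotated]) (use that in \<open>simp add: ract_def r\<close>)
  have ybe: "r12 r (r23 r (r12 r (x, y, z))) = r23 r (r12 r (r23 r (x, y, z)))"
    if "x \<in> X" "y \<in> X" "z \<in> X" for x y z
  proof -
    \<comment> \<open>In these coordinates the triple is
      \<open>(x, d x v, d (d x v) (d x w))\<close>. By \<open>r_dot\<close>, \<open>r12\<close> and
      \<open>r23\<close> swap neighbours in the word \<open>x v w\<close>, with \<open>cyc\<close>
      adjusting the last entry; both sides of the braid relation reverse the word.\<close>
    define v where "v = \<sigma> x y"
    define w where "w = \<sigma> x (\<sigma> y z)"
    have vw: "v \<in> X" "w \<in> X" using that by (simp_all add: v_def w_def sig)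
    have y: "y = d x v" and z: "z = d (d x v) (d x w)"
      using that by (simp_all add: v_def w_def dot_sig sig)
    have "r12 r (r23 r (r12 r (x, y, z))) = (w, d w v, d (d w v) (d w x))"
      using that(1) vw
      by (simp add: y z r12_def r23_def r_dot cyc[of x v w] dot cyc[of v w x])
    moreover have "r23 r (r12 r (r23 r (x, y, z))) = (w, d w v, d (d w v) (d w x))"
      using that(1) vw
      by (simp add: y z r12_def r23_def r_dot cyc[of x w v] dot)
    ultimately show ?thesis by simp
  qed
  show ?thesis
    unfolding ybe_solution_def
    using \<open>X \<noteq> {}\<close> left right' ybe by (auto simp: r sig dot sig_dot dot_sig)
qed

lemma int_periodic_1:
  fixes h :: "int \<Rightarrow> 'a"
  assumes "\<And>i. h (i + 1) = h i"
  shows "h i = h 0"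
proof (induction i rule: int_induct[where k = 0])
  case (step1 i)
  then show ?case using assms[of i] by simp
next
  case (step2 i)
  then show ?case using assms[of "i - 1"] by simp
qed (rule refl)

text \<open>Homomorphisms respect \<open>lact\<close> by definition; since
  \<open>lact s (f u)\<close> is injective on \<open>Y\<close>, it can be cancelled, which later
  makes the kernel compatible with \<open>idot\<close> as well.\<close>

lemma ybe_hom_kernel:
  assumes Y: "ybe_solution Y s" and f: "ybe_hom X r Y s f"
    and X: "u \<in> X" "u' \<in> X" "v \<in> X" "v' \<in> X"
    and eq: "f u = f u'" "f (lact r u v) = f (lact r u' v')"
  shows "f v = f v'"
proof -
  have "inj_on (lact s (f u)) Y" "f v \<in> Y" "f v' \<in> Y"
    using Y f X by (auto simp: ybe_solution_def ybe_hom_def bij_betw_def)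
  moreover have "lact s (f u) (f v) = lact s (f u) (f v')"
    using f X eq by (simp add: ybe_hom_def)
  ultimately show ?thesis by (auto dest: inj_onD)
qed

section \<open>Lift to integer triples\<close>

locale prime_power =
  fixes p n :: nat
  assumes prime: "prime p" and n_pos: "n > 0"
begin

abbreviation M :: int where "M \<equiv> int p ^ n"

lemma p_dvd_M: "int p dvd M"
  using n_pos by simp

lemma p_gt_1: "int p > 1"
  using prime_gt_1_nat[OF prime] by simp

lemma M_gt_1: "M > 1"
  using p_gt_1 n_pos by simp

lemma cong_M_p: "[x = y] (mod M) \<Longrightarrow> [x = y] (mod int p)"
  using p_dvd_M cong_dvd_modulus by blast

fun red :: "int \<times> int \<times> int \<Rightarrow> int \<times> int \<times> int" where
  "red (x, y, z) = (x mod M, y mod int p, z mod M)"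

definition kd :: "int \<Rightarrow> int \<Rightarrow> int \<Rightarrow> int \<Rightarrow> int" where
  "kd a b x y = of_bool ([a = x] (mod M) \<and> [b = y] (mod int p))"

text \<open>Nothing is reduced here: the canonical projection becomes the identity on integers, and
  \<open>isig u\<close> and \<open>idot u\<close> are exact mutual inverses.\<close>

fun isig :: "int \<times> int \<times> int \<Rightarrow> int \<times> int \<times> int \<Rightarrow> int \<times> int \<times> int" where
  "isig (a, b, c) (x, y, z) = (x - c, y + (a - x), z - kd a b (x - c) (y + (a - x)))"

fun idot :: "int \<times> int \<times> int \<Rightarrow> int \<times> int \<times> int \<Rightarrow> int \<times> int \<times> int" where
  "idot (a, b, c) (x, y, z) = (x + c, y + (x + c - a), z + kd a b x y)"

lemma red_eq_iff:
  "red (x, y, z) = red (x', y', z') \<longleftrightarrow>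
    [x = x'] (mod M) \<and> [y = y'] (mod int p) \<and> [z = z'] (mod M)"
  by (simp add: cong_def)

lemma red_red [simp]: "red (red u) = red u"
  by (cases u) simp

lemma red_in_carrier [simp]: "red u \<in> sol_carrier p n"
  using p_gt_1 M_gt_1 by (cases u) (auto simp: sol_carrier_def residue_ring_def)

lemma red_carrier: "u \<in> sol_carrier p n \<Longrightarrow> red u = u"
  by (cases u) (auto simp: sol_carrier_def residue_ring_def)

lemma finite_carrier: "finite (sol_carrier p n)"
  by (auto simp: sol_carrier_def residue_ring_def)

lemma kd_refl [simp]: "kd a b a b = 1"
  by (simp add: kd_def)

lemma kd_commute: "kd a b x y = kd x y a b"
  by (auto simp: kd_def cong_sym_eq)

lemma kd_cong:
  assumes "[a = a'] (mod M)" "[b = b'] (mod int p)" "[x = x'] (mod M)" "[y = y'] (mod int p)"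
  shows "kd a b x y = kd a' b' x' y'"
  using assms by (simp add: kd_def cong_def)

text \<open>Both pairs are moved by the same shear. Congruence of the first entries modulo
  \<open>M\<close> implies congruence modulo \<open>p\<close>, so the shear cancels in the second
  entries.\<close>

lemma kd_shear: "kd (x + c) (y + (x + c - a)) (s + c) (t + (s + c - a)) = kd x y s t"
proof -
  have "[y + (x + c - a) = t + (s + c - a)] (mod int p) \<longleftrightarrow> [y = t] (mod int p)"
    if "[x = s] (mod M)"
  proof -
    have "int p dvd x - s"
      using cong_M_p[OF that] by (simp add: cong_iff_dvd_diff)
    moreover have "y + (x + c - a) - (t + (s + c - a)) = (y - t) + (x - s)"
      by simp
    ultimately show ?thesis
      by (simp only: cong_iff_dvd_diff dvd_add_left_iff)
  qed
  then show ?thesis by (auto simp: kd_def cong_add_rcancel)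
qed

lemma isig_idot: "isig u (idot u v) = v"
  by (cases u; cases v) simp

lemma idot_isig: "idot u (isig u v) = v"
  by (cases u; cases v) simp

text \<open>By \<open>kd_shear\<close> the third entry of \<open>w\<close> gains one delta for
  \<open>u, w\<close> and one for \<open>v, w\<close>; the increments of the other entries are
  likewise symmetric in \<open>u\<close> and \<open>v\<close>.\<close>

lemma idot_cycle: "idot (idot u v) (idot u w) = idot (idot v u) (idot v w)"
  by (cases u; cases v; cases w) (simp add: kd_shear kd_commute)

lemma red_idot:
  assumes "red u = red u'" "red v = red v'"
  shows "red (idot u v) = red (idot u' v')"
proof -
  obtain a b c a' b' c' x y z x' y' z' where
    uv: "u = (a, b, c)" "u' = (a', b', c')" "v = (x, y, z)" "v' = (x', y', z')"
    by (metis prod_cases3)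
  have c: "[a = a'] (mod M)" "[b = b'] (mod int p)" "[c = c'] (mod M)"
    "[x = x'] (mod M)" "[y = y'] (mod int p)" "[z = z'] (mod M)"
    using assms by (simp_all add: uv red_eq_iff del: red.simps)
  show ?thesis
    unfolding uv idot.simps red_eq_iff kd_cong[OF c(1,2,4,5)]
    by (intro conjI cong_add cong_diff cong_refl c cong_M_p)
qed

lemma red_isig:
  assumes "red u = red u'" "red v = red v'"
  shows "red (isig u v) = red (isig u' v')"
proof -
  obtain a b c a' b' c' x y z x' y' z' where
    uv: "u = (a, b, c)" "u' = (a', b', c')" "v = (x, y, z)" "v' = (x', y', z')"
    by (metis prod_cases3)
  have c: "[a = a'] (mod M)" "[b = b'] (mod int p)" "[c = c'] (mod M)"
    "[x = x'] (mod M)" "[y = y'] (mod int p)" "[z = z'] (mod M)"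
    using assms by (simp_all add: uv red_eq_iff del: red.simps)
  have "kd a b (x - c) (y + (a - x)) = kd a' b' (x' - c') (y' + (a' - x'))"
    by (intro kd_cong cong_add cong_diff c cong_M_p)
  then show ?thesis
    unfolding uv isig.simps red_eq_iff
    by (simp only:) (intro conjI cong_add cong_diff cong_refl c cong_M_p)
qed

section \<open>Comparison with the residue rings, and the solution property\<close>

lemma sol_sigma_eq:
  assumes "u \<in> sol_carrier p n" "v \<in> sol_carrier p n"
  shows "sol_sigma p n u v = red (isig u v)"
proof -
  interpret RM: residues M "residue_ring M"
    using M_gt_1 by unfold_locales auto
  interpret RP: residues "int p" "Zp p"
    using p_gt_1 by unfold_locales auto
  obtain a b c x y z where uv: "u = (a, b, c)" "v = (x, y, z)"
    by (metis prod_cases3)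
  have bd: "a mod M = a" "b mod int p = b"
    using assms red_carrier[of u] by (auto simp: uv)
  have mod_M_p: "k mod M mod int p = k mod int p" for k
    using p_dvd_M by (rule mod_mod_cancel)
  have minus: "k \<ominus>\<^bsub>residue_ring M\<^esub> l = (k - l) mod M" for k l
    by (simp add: a_minus_def RM.res_add_eq RM.res_neg_eq mod_simps)
  have y': "y \<oplus>\<^bsub>Zp p\<^esub> canonical_proj p ((a - x) mod M) = (y + (a - x)) mod int p"
    by (simp add: RP.res_add_eq canonical_proj_def mod_M_p mod_simps)
  have "kronecker (Zpn p n) a ((x - c) mod M) \<otimes>\<^bsub>Zpn p n\<^esub>
      kronecker (Zpn p n) b ((y + (a - x)) mod int p) = kd a b (x - c) (y + (a - x))"
    using M_gt_1 bd
    by (auto simp: kronecker_def RM.res_mult_eq RM.res_one_eq RM.res_zero_eq kd_def cong_def)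
  then show ?thesis
    by (simp add: uv sol_sigma_def Let_def y' minus)
qed

text \<open>The image determines \<open>a - e\<close>, \<open>b - e\<close> and
  \<open>c + e\<close>, where \<open>e\<close> is the delta, so only \<open>e\<close> could be
  ambiguous. But \<open>e = 1\<close> means \<open>a + c = x\<close> modulo \<open>M\<close> and
  \<open>b - a = y - x\<close> modulo \<open>p\<close>, and the image determines both
  \<open>a + c\<close> and \<open>b - a\<close>.\<close>

lemma inj_on_gamma: "inj_on (\<lambda>u. red (idot (isig u v) u)) (sol_carrier p n)"
proof (rule inj_onI)
  obtain x y z where v: "v = (x, y, z)" by (metis prod_cases3)
  fix u u'
  assume X: "u \<in> sol_carrier p n" "u' \<in> sol_carrier p n"
    and eq: "red (idot (isig u v) u) = red (idot (isig u' v) u')"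
  obtain a b c a' b' c' where u: "u = (a, b, c)" "u' = (a', b', c')" by (metis prod_cases3)
  define e where "e = kd a b (x - c) (y + (a - x))"
  define e' where "e' = kd a' b' (x - c') (y + (a' - x))"
  have 1: "[a + (z - e) = a' + (z - e')] (mod M)"
    and 2: "[b + (a + (z - e) - (x - c)) = b' + (a' + (z - e') - (x - c'))] (mod int p)"
    and 3: "[c + e = c' + e'] (mod M)"
    using eq unfolding u v isig.simps idot.simps red_eq_iff e_def[symmetric] e'_def[symmetric]
      kd_commute[of "x - c" "y + (a - x)"] kd_commute[of "x - c'" "y + (a' - x)"] by auto
  have a: "[a - e = a' - e'] (mod M)"
    using 1 by (simp add: cong_iff_dvd_diff algebra_simps)
  have ac: "[a + c = a' + c'] (mod M)"
    using cong_add[OF a 3] by (simp add: algebra_simps)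
  \<comment> \<open>The second entry equals \<open>(b - e) + (a + c) + (z - x)\<close>, and
    \<open>a + c\<close> is already matched.\<close>
  have b: "[b - e = b' - e'] (mod int p)"
    using cong_diff[OF 2 cong_add[OF cong_M_p[OF ac] cong_refl[of "z - x"]]]
    by (simp add: algebra_simps)
  have clash: False
    if h: "[a - 1 = a'] (mod M)" "[b - 1 = b'] (mod int p)" "[a + c = a' + c'] (mod M)"
      "kd a b (x - c) (y + (a - x)) = 1" "kd a' b' (x - c') (y + (a' - x)) = 0" for a b c a' b' c'
  proof -
    have k: "[a = x - c] (mod M)" "[b = y + (a - x)] (mod int p)"
      using h(4) by (auto simp: kd_def split: if_splits)
    have "[a + c = x] (mod M)"
      using k(1) by (simp add: cong_iff_dvd_diff algebra_simps)
    then have "[a' + c' = x] (mod M)"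
      using h(3) cong_sym cong_trans by blast
    then have "[a' = x - c'] (mod M)"
      by (simp add: cong_iff_dvd_diff algebra_simps)
    moreover have "[b' = y + (a' - x)] (mod int p)"
    proof -
      have "[b - 1 = y + (a - x) - 1] (mod int p)"
        using k(2) by (intro cong_diff cong_refl)
      also have "y + (a - x) - 1 = y + ((a - 1) - x)" by simp
      also have "[y + ((a - 1) - x) = y + (a' - x)] (mod int p)"
        using cong_M_p[OF h(1)] by (intro cong_add cong_diff cong_refl)
      finally show ?thesis using h(2) cong_sym cong_trans by blast
    qed
    ultimately show False using h(5) by (simp add: kd_def)
  qed
  have "e = e'"
  proof (rule ccontr)
    assume "e \<noteq> e'"
    then consider "e = 1" "e' = 0" | "e = 0" "e' = 1"
      by (auto simp: e_def e'_def kd_def of_bool_def split: if_splits)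
    then show False
    proof cases
      case 1
      then show False using clash[of a a' b b' c c'] a b ac by (simp add: e_def e'_def)
    next
      case 2
      then show False using clash[of a' a b' b c' c] a b ac
        by (simp add: e_def e'_def cong_sym_eq)
    qed
  qed
  then have "[a = a'] (mod M)" "[b = b'] (mod int p)" "[c = c'] (mod M)"
    using a b 3 by (auto simp: cong_iff_dvd_diff)
  then have "red u = red u'" by (simp only: u red_eq_iff)
  then show "u = u'" using X by (simp add: red_carrier)
qed

lemma sol_r_eq:
  assumes X: "u \<in> sol_carrier p n" "v \<in> sol_carrier p n"
  shows "sol_r p n (u, v) = (red (isig u v), red (idot (red (isig u v)) u))"
proof -
  define w where "w = red (isig u v)"
  have w: "w \<in> sol_carrier p n" by (simp add: w_def)
  \<comment> \<open>Injectivity is what pins down the value of \<open>inv_into\<close> as that of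
    \<open>idot\<close>.\<close>
  have inj: "inj_on (sol_sigma p n w) (sol_carrier p n)"
  proof (rule inj_on_inverseI)
    fix t assume t: "t \<in> sol_carrier p n"
    have "red (idot w (red (isig w t))) = red (idot w (isig w t))"
      by (intro red_idot) auto
    then show "red (idot w (sol_sigma p n w t)) = t"
      using w t by (simp add: sol_sigma_eq idot_isig red_carrier)
  qed
  have "red (isig w (red (idot w u))) = red (isig w (idot w u))"
    by (intro red_isig) auto
  then have "sol_sigma p n w (red (idot w u)) = u"
    using w X by (simp add: sol_sigma_eq isig_idot red_carrier)
  then have "inv_into (sol_carrier p n) (sol_sigma p n w) u = red (idot w u)"
    by (intro inv_into_f_eq inj) auto
  then show ?thesis
    using X by (simp add: sol_r_def sol_sigma_eq w_def)
qed

theorem ybe_solution_sol_r: "ybe_solution (sol_carrier p n) (sol_r p n)"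
proof (rule ybe_solution_from_cycle_set[where \<sigma> = "\<lambda>u v. red (isig u v)"
      and d = "\<lambda>u v. red (idot u v)"])
  show "sol_carrier p n \<noteq> {}" using red_in_carrier by blast
next
  fix u v assume X: "u \<in> sol_carrier p n" "v \<in> sol_carrier p n"
  have "red (isig u (red (idot u v))) = red (isig u (idot u v))"
    by (intro red_isig) auto
  then show "red (isig u (red (idot u v))) = v"
    using X by (simp add: isig_idot red_carrier)
  have "red (idot u (red (isig u v))) = red (idot u (isig u v))"
    by (intro red_idot) auto
  then show "red (idot u (red (isig u v))) = v"
    using X by (simp add: idot_isig red_carrier)
next
  fix u v w
  have "red (idot (red (idot u v)) (red (idot u w))) = red (idot (idot u v) (idot u w))" for u v w
    by (intro red_idot) auto
  then show "red (idot (red (idot u v)) (red (idot u w))) =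
      red (idot (red (idot v u)) (red (idot v w)))"
    by (simp add: idot_cycle)
next
  fix v
  have "red (idot (red (isig u v)) u) = red (idot (isig u v) u)" for u
    by (intro red_idot) auto
  then have "inj_on (\<lambda>u. red (idot (red (isig u v)) u)) (sol_carrier p n)"
    using inj_on_gamma[of v] by simp
  then show "bij_betw (\<lambda>u. red (idot (red (isig u v)) u)) (sol_carrier p n) (sol_carrier p n)"
    unfolding bij_betw_def by (intro conjI endo_inj_surj finite_carrier) auto
qed (simp_all add: sol_r_eq)

end

section \<open>Quotients that identify two distinct points\<close>

locale prime_power_quotient = prime_power +
  fixes g :: "int \<times> int \<times> int \<Rightarrow> 'b"
  assumes g_red: "red u = red v \<Longrightarrow> g u = g v"
    and g_idot: "g u = g u' \<Longrightarrow> g v = g v' \<Longrightarrow> g (idot u v) = g (idot u' v')"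
    and g_isig: "g u = g u' \<Longrightarrow> g v = g v' \<Longrightarrow> g (isig u v) = g (isig u' v')"
begin

lemma g_cong:
  "[x = x'] (mod M) \<Longrightarrow> [y = y'] (mod int p) \<Longrightarrow> [z = z'] (mod M) \<Longrightarrow> g (x, y, z) = g (x', y', z')"
  by (rule g_red) (simp only: red_eq_iff)

lemma g_shift:
  assumes "g (a, b, c) = g (a', b', c')"
  shows "g (s + (c - c'), t + (a' - a), q + kd a b s t - kd a' b' (s + (c - c')) (t + (a' - a))) =
    g (s, t, q)"
proof -
  have "g (isig (a', b', c') (idot (a, b, c) (s, t, q))) =
      g (isig (a', b', c') (idot (a', b', c') (s, t, q)))"
    using assms by (intro g_isig g_idot refl)
  then have "g (isig (a', b', c') (idot (a, b, c) (s, t, q))) = g (s, t, q)"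
    by (simp only: isig_idot)
  then show ?thesis by (simp add: algebra_simps)
qed

lemma vertical_from_base:
  assumes eq: "g (a, b, c) = g (a', b', c)"
    and ne: "\<not> ([a = a'] (mod M) \<and> [b = b'] (mod int p))"
  shows "g (a, b, q + 1) = g (a, b, q)"
proof (cases "int p dvd a' - a")
  case True
  \<comment> \<open>The second coordinate is fixed modulo \<open>p\<close>, so one shift at
    \<open>(a, b)\<close> is enough: there the first delta is 1 and the second 0.\<close>
  have "[b + (a' - a) = b] (mod int p)"
    using True by (simp add: cong_iff_dvd_diff)
  then have "kd a' b' a (b + (a' - a)) = 0"
    using ne by (auto simp: kd_def cong_sym_eq dest: cong_trans cong_sym)
  then have "g (a, b + (a' - a), q + 1) = g (a, b, q)"
    using g_shift[OF eq, of a b q] by simp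
  moreover have "g (a, b + (a' - a), q + 1) = g (a, b, q + 1)"
    using True by (intro g_cong) (auto simp: cong_iff_dvd_diff)
  ultimately show ?thesis by simp
next
  case False
  define k where "k = a' - a"
  have "\<not> [a' = a] (mod M)"
    using False cong_M_p by (auto simp: cong_iff_dvd_diff)
  then have shift: "g (a, t + k, q + kd a b a t) = g (a, t, q)" for t q
    using g_shift[OF eq, of a t q] by (simp add: kd_def k_def)
  \<comment> \<open>Over \<open>a\<close> the second delta always vanishes, and the first is 1 only
    at \<open>b\<close>. The step \<open>j = 0\<close> leaves \<open>b\<close> and gains 1; as
    \<open>p\<close> is prime, the multiples of \<open>k\<close> first return to \<open>b\<close>
    after \<open>p\<close> steps, so nothing more is gained.\<close>
  have step: "g (a, b + int (Suc j) * k, q + 1) = g (a, b, q)" if "j < p" for j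
    using that
  proof (induction j)
    case 0
    then show ?case using shift[of b q] by (simp add: kd_def)
  next
    case (Suc j)
    have "\<not> int p dvd int (Suc j) * k"
      using Suc.prems False prime
      by (auto simp: prime_dvd_mult_iff k_def simp del: of_nat_Suc dest: zdvd_imp_le)
    then have "\<not> [b = b + int (Suc j) * k] (mod int p)"
      by (simp add: cong_iff_dvd_diff)
    then have "kd a b a (b + int (Suc j) * k) = 0"
      by (simp add: kd_def)
    with shift[of "b + int (Suc j) * k" "q + 1"]
    have "g (a, b + int (Suc (Suc j)) * k, q + 1) = g (a, b + int (Suc j) * k, q + 1)"
      by (simp add: algebra_simps)
    then show ?case using Suc by simp
  qed
  have "p > 0" using prime by (simp add: prime_gt_0_nat)
  then have "g (a, b + int p * k, q + 1) = g (a, b, q)"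
    using step[of "p - 1"] by simp
  moreover have "g (a, b + int p * k, q + 1) = g (a, b, q + 1)"
    by (intro g_cong) (auto simp: cong_iff_dvd_diff)
  ultimately show ?thesis by simp
qed

lemma vertical:
  assumes eq: "g u = g v" and ne: "red u \<noteq> red v"
  obtains a b where "\<And>q. g (a, b, q + 1) = g (a, b, q)"
proof -
  obtain a b c a' b' c' where uv: "u = (a, b, c)" "v = (a', b', c')" by (metis prod_cases3)
  note eq = eq[unfolded uv]
  show thesis
  proof (cases "[c = c'] (mod M)")
    case True
    have "g (a', b', c') = g (a', b', c)"
      using True by (intro g_cong) (auto simp: cong_sym_eq)
    then have "g (a, b, c) = g (a', b', c)" using eq by simp
    moreover have "\<not> ([a = a'] (mod M) \<and> [b = b'] (mod int p))"
      using ne True unfolding uv red_eq_iff by blast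
    ultimately show thesis using vertical_from_base that by blast
  next
    case False
    define d k where "d = c - c'" and "k = a' - a"
    have b1: "\<not> [b = b + 1] (mod int p)"
      using p_gt_1 by (simp add: cong_iff_dvd_diff)
    have a1: "\<not> [a + 1 + d = a + d] (mod M)"
      using M_gt_1 by (simp add: cong_iff_dvd_diff)
    \<comment> \<open>Taking \<open>t = b + 1\<close> kills the first delta. The second can be 1 for
      at most one \<open>s\<close> modulo \<open>M\<close>, so \<open>a\<close> or
      \<open>a + 1\<close> serves.\<close>
    obtain s t where st: "kd a b s t = 0" "kd a' b' (s + d) (t + k) = 0"
    proof (cases "kd a' b' (a + d) (b + 1 + k) = 0")
      case True
      then show thesis using that[of a "b + 1"] b1 by (simp add: kd_def)
    next
      case False
      then have "[a' = a + d] (mod M)" by (auto simp: kd_def)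
      then have "\<not> [a' = a + 1 + d] (mod M)"
        using a1 by (meson cong_sym cong_trans)
      then show thesis using that[of "a + 1" "b + 1"] b1 by (simp add: kd_def)
    qed
    have "g (s + d, t + k, 0) = g (s, t, 0)"
      using g_shift[OF eq, of s t 0] st by (simp add: d_def k_def)
    moreover have "\<not> [s + d = s] (mod M)"
      using False by (simp add: cong_iff_dvd_diff d_def)
    ultimately show thesis using vertical_from_base that by blast
  qed
qed

lemma g_constant:
  assumes "g u = g v" and "red u \<noteq> red v"
  shows "g w = g (0, 0, 0)"
proof -
  obtain a b where ab: "\<And>q. g (a, b, q + 1) = g (a, b, q)"
    using vertical[OF assms] by blast
  have inc: "g (s, t, q + 1) = g (s, t, q)" for s t q
  proof -
    \<comment> \<open>The acting point is chosen so that \<open>idot\<close> carries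
      \<open>(a, b)\<close> to \<open>(s, t)\<close>; subtracting \<open>e\<close> compensates the
      delta.\<close>
    define e where "e = kd (s - (t - b)) 0 a b"
    have "g (idot (s - (t - b), 0, s - a) (a, b, q - e + 1)) =
        g (idot (s - (t - b), 0, s - a) (a, b, q - e))"
      by (intro g_idot refl ab)
    then show ?thesis by (simp add: e_def algebra_simps)
  qed
  have vert: "g (s, t, q) = g (s, t, 0)" for s t q
    using inc by (rule int_periodic_1)
  \<comment> \<open>By \<open>vert\<close> the third coordinate is irrelevant, so the deltas of
    \<open>g_shift\<close> disappear.\<close>
  have shift: "g (s + (c - c'), t + (a' - a), 0) = g (s, t, 0)"
    if "g (a, b, c) = g (a', b', c')" for a b c a' b' c' s t
    by (rule trans[OF vert[symmetric] g_shift[OF that]])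
  have inc_s: "g (s + 1, t, 0) = g (s, t, 0)" for s t
    using shift[OF inc[of 0 0 0], of s t] by simp
  have hor: "g (s, t, 0) = g (0, t, 0)" for s t
    using inc_s by (rule int_periodic_1)
  \<comment> \<open>The equality is reversed because the second coordinate moves by
    \<open>a' - a\<close>, opposite in sign to \<open>c - c'\<close>.\<close>
  have inc_t: "g (0, t + 1, 0) = g (0, t, 0)" for t
    using shift[OF hor[of 1 0, symmetric], of 0 t] by simp
  have depth: "g (0, t, 0) = g (0, 0, 0)" for t
    using inc_t by (rule int_periodic_1)
  obtain s t q where w: "w = (s, t, q)" by (metis prod_cases3)
  show ?thesis
    unfolding w vert[of s t q] hor[of s t] by (rule depth)
qed

end

section \<open>Simplicity for arbitrary epimorphisms\<close>

theorem theorem3p2: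
  fixes p n :: nat
  assumes "prime p" and "n > 0"
  shows "simple_ybe_solution TYPE('b) (sol_carrier p n) (sol_r p n)"
proof -
  interpret prime_power p n using assms by unfold_locales
  let ?X = "sol_carrier p n" and ?r = "sol_r p n"
  have lact_sig: "lact ?r (red u) (red v) = red (isig u v)" for u v
    by (simp add: lact_def sol_r_eq) (intro red_isig; simp)
  have "ybe_iso ?X ?r Y s f \<or> card Y = 1"
    if Y: "ybe_solution Y s" and epi: "ybe_epi ?X ?r Y s f" for Y :: "'b set" and s f
  proof (cases "inj_on f ?X")
    case True
    then show ?thesis using epi by (simp add: ybe_iso_def ybe_epi_def bij_betw_def)
  next
    case False
    have hom: "ybe_hom ?X ?r Y s f" and img: "f ` ?X = Y"
      using epi by (simp_all add: ybe_epi_def)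
    \<comment> \<open>Composing with \<open>red\<close> extends \<open>f\<close> to all integer
      triples, where the exact identities for \<open>isig\<close> and \<open>idot\<close>
      apply.\<close>
    define g where "g = f \<circ> red"
    interpret prime_power_quotient p n g
    proof
      fix u v u' v'
      show "g u = g v" if "red u = red v" using that by (simp add: g_def)
      assume eq: "g u = g u'" "g v = g v'"
      have "f (lact ?r (red u) (red v)) = f (lact ?r (red u') (red v'))"
        using hom eq by (simp add: ybe_hom_def g_def)
      then show "g (isig u v) = g (isig u' v')" by (simp add: lact_sig g_def)
      \<comment> \<open>As \<open>isig u (idot u v) = v\<close>, the images agree after applying
        \<open>lact\<close>, which \<open>ybe_hom_kernel\<close> cancels.\<close>
      show "g (idot u v) = g (idot u' v')"
        unfolding g_def comp_def
        by (rule ybe_hom_kernel[OF Y hom, of "red u" "red u'"])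
          (use eq in \<open>simp_all add: lact_sig isig_idot g_def\<close>)
    qed
    from False obtain u v where "u \<in> ?X" "v \<in> ?X" "f u = f v" "u \<noteq> v"
      unfolding inj_on_def by blast
    then have "g u = g v" "red u \<noteq> red v" by (simp_all add: g_def red_carrier)
    then have "g w = g (0, 0, 0)" for w by (rule g_constant)
    then have "f w = g (0, 0, 0)" if "w \<in> ?X" for w
      using red_carrier[OF that] by (metis comp_apply g_def)
    then have "f ` ?X = (\<lambda>_. g (0, 0, 0)) ` ?X"
      by (rule image_cong[OF refl])
    then have "Y = {g (0, 0, 0)}"
      unfolding img image_constant[OF red_in_carrier] .
    then show ?thesis by simp
  qed
  moreover have "red (0, 0, 0) \<noteq> red (0, 1, 0)"
    using p_gt_1 by simp
  then have "\<exists>x\<in>?X. \<exists>y\<in>?X. x \<noteq> y"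
    using red_in_carrier by blast
  ultimately show ?thesis
    unfolding simple_ybe_solution_def using ybe_solution_sol_r by blast
qed

end
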